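(* Let $X$ be an ISL. (1) If $x\in X$ is $D_n$-cyclic in $X$, then for every nonempty $\sigma\subset\mathbb N$ the element $R_\sigma x$ is $D_n$-cyclic in $R_\sigma X$. In particular, if $x$ is cyclic and multiplicative, then for every $j$ the function $f_j$ is $z$-cyclic in $X_j$. (2) Assume the norm $\|\cdot\|_X$ is multiplicative. Then the converse holds: if $x\in X$ is multiplicative and every $f_j$ ($j\ge1$) is $z$-cyclic in $X_j$, then $x$ is $D_n$-cyclic in $X$. (3) If $x\in X$ is multiplicative and all $f_j$ ($j\ge 1$) and all $F_N$ ($N\ge1$) belong to $\mathrm{Mult}(X)$, then the converse to (1) holds: $z$-cyclicity of every $f_j$ in $X_j$ implies $D_n$-cyclicity of $x$ in $X$.
   Context: An ISL (invariant sequence lattice) is a Banach space $X$ of complex sequences $x=(x_n)_{n\ge1}$ such that: (i) if $x\in X$ and $|y_n|\le|x_n|$ for all $n$, then $y\in X$ and $\|y\|_X\le\|x\|_X$; (ii) for every $n\ge1$ the dilation $D_n\big(\sum_kx_k\delta_k\big)=\sum_kx_k\delta_{nk}$ maps $X$ into $X$; (iii) $\delta_1\in X$ (here $\delta_k$ are the standard unit vectors). $X'=\{y:\sum_n|x_ny_n|<\infty\ \forall x\in X\}$, $\langle x,y\rangle=\sum_nx_ny_n$, and $\sigma(X,X')$ is the corresponding weak topology on $X$. An element $x\in X$ is $D_n$-cyclic if the $\sigma(X,X')$-closed linear span of $\{D_nx:n\ge1\}$ is $X$. Bohr transform: let $p_1=2,p_2=3,\dots$ be the primes, $\mathbb Z_+(\infty)$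 the set of finitely supported sequences of nonnegative integers, and for $n=\prod_jp_j^{\alpha_j}$ put $\alpha(n)=(\alpha_1,\alpha_2,\dots)\in\mathbb Z_+(\infty)$. For a sequence $x$, $Bx=\sum_nx_n\zeta^{\alpha(n)}$ is a (formal) power series in $\zeta=(\zeta_1,\zeta_2,\dots)$, $\zeta^\alpha=\prod_j\zeta_j^{\alpha_j}$. Sequences in $X$ are identified with their Bohr transforms, with $\|Bx\|_X:=\|x\|_X$; products are products of power series, so $D_n$ corresponds to multiplication by $\zeta^{\alpha(n)}$. For $\sigma\subset\mathbb N$, $R_\sigma x$ is defined by $(R_\sigma x)_n=x_n$ if $\operatorname{supp}\alpha(n)\subset\sigma$ and $(R_\sigma x)_n=0$ otherwise; $R_\sigma X=\{R_\sigma x:x\in X\}\subset X$ with the norm of $X$. $D_n$-cyclicity of $y$ in $R_\sigma X$ means that the span of $\{D_ny:\operatorname{supp}\alpha(n)\subset\sigma\}$ is dense in $R_\sigma X$ for the topology induced by $\sigma(X,X')$. A sequence $x$ is multiplicative if $x_1=1$ and $x_{nk}=x_nx_k$ whenever $\gcd(n,k)=1$. For multiplicative $x$, set $f_j(z)=\sum_{k\ge0}x_{p_j^k}z^k$ (so $f_j(\zeta_j)=B(R_{\{j\}}x)$) and $F_N=B(R_{\{N+1,N+2,\dots\}}x)$; then $Bx=f_1(\zeta_1)\cdots f_N(\zeta_N)F_N(\zeta)$ for every $N$. $X_j=\{f=\sum_{k\ge0}a_kz^k: a_k=y_{p_j^k},\ y\in X\}$ is $B(R_{\{j\}}X)$ viewed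 as a space of power series in one variable $z=\zeta_j$, with the norm induced from $X$; $f\in X_j$ is $z$-cyclic if $\{qf:q\text{ a polynomial in }z\}$ is dense in $X_j$ for the topology induced by $\sigma(X,X')$. The norm $\|\cdot\|_X$ is multiplicative if for all $\sigma,\sigma'\subset\mathbb N$ with $\sigma\cap\sigma'=\emptyset$ and all $f\in R_\sigma X$, $g\in R_{\sigma'}X$ (as power series) one has $fg\in X$ and $\|fg\|_X=\|f\|_X\|g\|_X$. $\mathrm{Mult}(X)$ is the set of power series $F$ in $\zeta$ such that $Ff\in BX$ for every $f\in BX$, where $BX=\{Bx:x\in X\}$. *)

theory Defs
  imports
    "HOL-Analysis.Analysis"
    "HOL-Library.Poly_Mapping"
    "HOL-Library.Function_Algebras"
    "HOL-Computational_Algebra.Primes"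
    "HOL-Computational_Algebra.Polynomial_FPS"
begin

text \<open>
  A complex sequence indexed by the positive integers is a function of type nat to complex
  that vanishes at 0. Addition and subtraction of sequences are pointwise
  (theory Function_Algebras); spans are complex linear spans.
\<close>

type_synonym seq = "nat \<Rightarrow> complex"

definition seq_scale :: "complex \<Rightarrow> seq \<Rightarrow> seq" where
  "seq_scale c x = (\<lambda>n. c * x n)"

lemma vector_space_seq_scale: "vector_space seq_scale"
  by unfold_locales (auto simp: seq_scale_def fun_eq_iff algebra_simps)

definition unit_seq :: "nat \<Rightarrow> seq" where
  "unit_seq k = (\<lambda>n. if n = k then 1 else 0)"

definition dilation :: "nat \<Rightarrow> seq \<Rightarrow> seq" where
  "dilation n x = (\<lambda>m. if n dvd m then x (m div n) else 0)"

lemma dilation_unit_seq: "n \<ge> 1 \<Longrightarrow> dilation n (unit_seq k) = unit_seq (n * k)"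
  by (auto simp: dilation_def unit_seq_def fun_eq_iff)

text \<open>The space is the pair of its carrier \<open>X\<close> and its norm \<open>nrm\<close>,
  whose values outside \<open>X\<close> are irrelevant.\<close>

locale ISL =
  fixes X :: "seq set" and nrm :: "seq \<Rightarrow> real"
  assumes at_0: "x \<in> X \<Longrightarrow> x 0 = 0"
    and subspace: "module.subspace seq_scale X"
    and norm_nonneg: "x \<in> X \<Longrightarrow> 0 \<le> nrm x"
    and norm_eq_0: "x \<in> X \<Longrightarrow> nrm x = 0 \<longleftrightarrow> x = 0"
    and norm_triangle: "x \<in> X \<Longrightarrow> y \<in> X \<Longrightarrow> nrm (x + y) \<le> nrm x + nrm y"
    and norm_scale: "x \<in> X \<Longrightarrow> nrm (seq_scale c x) = cmod c * nrm x"
    and complete: "(\<And>i. u i \<in> X) \<Longrightarrow>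
        (\<forall>e>0. \<exists>M. \<forall>i\<ge>M. \<forall>j\<ge>M. nrm (u i - u j) < e) \<Longrightarrow>
        \<exists>l\<in>X. (\<lambda>i. nrm (u i - l)) \<longlonglongrightarrow> (0::real)"
    and solid: "x \<in> X \<Longrightarrow> (\<And>n. cmod (y n) \<le> cmod (x n)) \<Longrightarrow> y \<in> X \<and> nrm y \<le> nrm x"
    and dilation_closed: "n \<ge> 1 \<Longrightarrow> x \<in> X \<Longrightarrow> dilation n x \<in> X"
    and unit_mem: "unit_seq 1 \<in> X"

definition kothe_dual :: "seq set \<Rightarrow> seq set" where
  "kothe_dual X = {y. y 0 = 0 \<and> (\<forall>x\<in>X. summable (\<lambda>n. cmod (x n * y n)))}"

definition pairing :: "seq \<Rightarrow> seq \<Rightarrow> complex" where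
  "pairing x y = suminf (\<lambda>n. x n * y n)"

definition weak_top :: "seq set \<Rightarrow> seq topology" where
  "weak_top X =
     topology_generated_by {{x\<in>X. pairing x y \<in> U} | y U. y \<in> kothe_dual X \<and> open U}"

definition cyclic :: "seq set \<Rightarrow> seq \<Rightarrow> bool" where
  "cyclic X x \<longleftrightarrow> x \<in> X \<and>
     weak_top X closure_of module.span seq_scale {dilation n x | n. n \<ge> 1} = X"

text \<open>
  Prime indices and the variables of power series are counted from 0 (the first prime
  \<open>nth_prime 0 = 2\<close> belongs to the first variable), so the index set of the variables is
  all of nat. A multi-index is a finitely supported function; \<open>keys\<close> is its support.
\<close>

type_synonym mindex = "nat \<Rightarrow>\<^sub>0 nat"

type_synonym mps = "mindex \<Rightarrow> complex"

definition nth_prime :: "nat \<Rightarrow> nat" where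
  "nth_prime j = enumerate {p. prime p} j"

lemma prime_nth_prime: "prime (nth_prime j)"
  using enumerate_in_set[OF primes_infinite, of j] by (simp add: nth_prime_def)

lemma inj_nth_prime: "inj nth_prime"
  using inj_enumerate[OF primes_infinite] by (simp add: inj_on_def nth_prime_def)

lemma nth_prime_surj: "prime p \<Longrightarrow> \<exists>j. nth_prime j = p"
  using enumerate_Ex[OF primes_infinite, of p] by (auto simp: nth_prime_def)

lift_definition exponents :: "nat \<Rightarrow> mindex" is
  "\<lambda>n j. multiplicity (nth_prime j) n"
proof -
  fix n :: nat
  show "finite {j. multiplicity (nth_prime j) n \<noteq> 0}"
  proof (cases "n = 0")
    case False
    have "nth_prime j \<le> n" if "multiplicity (nth_prime j) n \<noteq> 0" for j
      using that False not_dvd_imp_multiplicity_0 dvd_imp_le gr0I by metis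
    then have "nth_prime ` {j. multiplicity (nth_prime j) n \<noteq> 0} \<subseteq> {..n}"
      by blast
    then show ?thesis
      by (meson finite_atMost finite_imageD finite_subset inj_nth_prime inj_on_subset subset_UNIV)
  qed simp
qed

definition index_nat :: "mindex \<Rightarrow> nat" where
  "index_nat \<alpha> = (\<Prod>j\<in>Poly_Mapping.keys \<alpha>. nth_prime j ^ Poly_Mapping.lookup \<alpha> j)"

definition bohr :: "seq \<Rightarrow> mps" where
  "bohr x = (\<lambda>\<alpha>. x (index_nat \<alpha>))"

definition inv_bohr :: "mps \<Rightarrow> seq" where
  "inv_bohr F = (\<lambda>n. if n = 0 then 0 else F (exponents n))"

lemma index_nat_pos: "index_nat \<alpha> > 0"
  by (auto simp: index_nat_def prime_gt_0_nat prime_nth_prime intro!: prod_pos)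

lemma multiplicity_index_nat: "multiplicity (nth_prime j) (index_nat \<alpha>) = Poly_Mapping.lookup \<alpha> j"
proof -
  define S where "S = nth_prime ` Poly_Mapping.keys \<alpha>"
  have "index_nat \<alpha> = (\<Prod>p\<in>S. p ^ Poly_Mapping.lookup \<alpha> (inv nth_prime p))"
    using inj_nth_prime unfolding index_nat_def S_def
    by (subst prod.reindex) (auto intro: inj_on_subset)
  moreover have "multiplicity (nth_prime j) (\<Prod>p\<in>S. p ^ Poly_Mapping.lookup \<alpha> (inv nth_prime p)) =
      (if nth_prime j \<in> S then Poly_Mapping.lookup \<alpha> (inv nth_prime (nth_prime j)) else 0)"
    by (rule multiplicity_prod_prime_powers) (auto simp: S_def prime_nth_prime)
  ultimately show ?thesis
    using inj_nth_prime by (auto simp: S_def inj_image_mem_iff in_keys_iff)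
qed

lemma exponents_index_nat: "exponents (index_nat \<alpha>) = \<alpha>"
  by (rule poly_mapping_eqI) (simp add: exponents.rep_eq multiplicity_index_nat)

lemma index_nat_exponents: "n \<ge> 1 \<Longrightarrow> index_nat (exponents n) = n"
proof (rule multiplicity_eq_nat)
  fix p :: nat
  assume "prime p"
  then obtain j where "p = nth_prime j"
    using nth_prime_surj by metis
  then show "multiplicity p (index_nat (exponents n)) = multiplicity p n"
    by (simp add: multiplicity_index_nat exponents.rep_eq)
qed (simp_all add: index_nat_pos)

lemma inv_bohr_bohr: "x 0 = 0 \<Longrightarrow> inv_bohr (bohr x) = x"
  by (auto simp: inv_bohr_def bohr_def fun_eq_iff index_nat_exponents)

lemma bohr_inv_bohr: "bohr (inv_bohr F) = F"
  using index_nat_pos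
  by (simp add: inv_bohr_def bohr_def fun_eq_iff exponents_index_nat less_imp_neq[THEN not_sym])

text \<open>Every multi-index has only finitely many decompositions, so the sum is finite.\<close>

definition mps_mult :: "mps \<Rightarrow> mps \<Rightarrow> mps" where
  "mps_mult F G = (\<lambda>\<gamma>. \<Sum>(\<alpha>, \<beta>) | \<alpha> + \<beta> = \<gamma>. F \<alpha> * G \<beta>)"

definition mps_norm :: "(seq \<Rightarrow> real) \<Rightarrow> mps \<Rightarrow> real" where
  "mps_norm nrm F = nrm (inv_bohr F)"

definition restrict_vars :: "nat set \<Rightarrow> seq \<Rightarrow> seq" where
  "restrict_vars \<sigma> x = (\<lambda>n. if Poly_Mapping.keys (exponents n) \<subseteq> \<sigma> then x n else 0)"

definition cyclic_in :: "seq set \<Rightarrow> nat set \<Rightarrow> seq \<Rightarrow> bool" where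
  "cyclic_in X \<sigma> y \<longleftrightarrow> y \<in> restrict_vars \<sigma> ` X \<and>
     subtopology (weak_top X) (restrict_vars \<sigma> ` X) closure_of
       module.span seq_scale {dilation n y | n. n \<ge> 1 \<and> Poly_Mapping.keys (exponents n) \<subseteq> \<sigma>}
     = restrict_vars \<sigma> ` X"

definition multiplicative :: "seq \<Rightarrow> bool" where
  "multiplicative x \<longleftrightarrow> x 1 = 1 \<and>
     (\<forall>n\<ge>1. \<forall>k\<ge>1. coprime n k \<longrightarrow> x (n * k) = x n * x k)"

definition prime_factor :: "nat \<Rightarrow> seq \<Rightarrow> complex fps" where
  "prime_factor j x = Abs_fps (\<lambda>k. x (nth_prime j ^ k))"

text \<open>The first \<open>N\<close> variables are numbered \<open>0, ..., N - 1\<close>.\<close>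

definition tail_factor :: "nat \<Rightarrow> seq \<Rightarrow> mps" where
  "tail_factor N x = bohr (restrict_vars {N..} x)"

text \<open>\<open>in_var j f\<close> is the univariate series \<open>f\<close> evaluated at the variable number \<open>j\<close>.\<close>

definition in_var :: "nat \<Rightarrow> complex fps \<Rightarrow> mps" where
  "in_var j f = (\<lambda>\<alpha>. if Poly_Mapping.keys \<alpha> \<subseteq> {j} then fps_nth f (Poly_Mapping.lookup \<alpha> j) else 0)"

lemma in_var_prime_factor: "in_var j (prime_factor j x) = bohr (restrict_vars {j} x)"
proof
  fix \<alpha> :: mindex
  have "index_nat \<alpha> = nth_prime j ^ Poly_Mapping.lookup \<alpha> j" if "Poly_Mapping.keys \<alpha> \<subseteq> {j}"
    using that by (cases "Poly_Mapping.keys \<alpha> = {}") (auto simp: index_nat_def subset_singleton_iff)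
  then show "in_var j (prime_factor j x) \<alpha> = bohr (restrict_vars {j} x) \<alpha>"
    by (auto simp: in_var_def prime_factor_def bohr_def restrict_vars_def exponents_index_nat)
qed

definition var_space :: "seq set \<Rightarrow> nat \<Rightarrow> complex fps set" where
  "var_space X j = prime_factor j ` X"

definition var_top :: "seq set \<Rightarrow> nat \<Rightarrow> complex fps topology" where
  "var_top X j = pullback_topology (var_space X j) (\<lambda>f. inv_bohr (in_var j f)) (weak_top X)"

definition z_cyclic :: "seq set \<Rightarrow> nat \<Rightarrow> complex fps \<Rightarrow> bool" where
  "z_cyclic X j f \<longleftrightarrow> f \<in> var_space X j \<and>
     var_top X j closure_of {fps_of_poly q * f | q. True} = var_space X j"

definition multiplicative_norm :: "seq set \<Rightarrow> (seq \<Rightarrow> real) \<Rightarrow> bool" where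
  "multiplicative_norm X nrm \<longleftrightarrow>
     (\<forall>\<sigma> \<sigma>'. \<sigma> \<inter> \<sigma>' = {} \<longrightarrow>
       (\<forall>f \<in> bohr ` restrict_vars \<sigma> ` X. \<forall>g \<in> bohr ` restrict_vars \<sigma>' ` X.
          mps_mult f g \<in> bohr ` X \<and>
          mps_norm nrm (mps_mult f g) = mps_norm nrm f * mps_norm nrm g))"

definition Mult :: "seq set \<Rightarrow> mps set" where
  "Mult X = {F. \<forall>f \<in> bohr ` X. mps_mult F f \<in> bohr ` X}"

end

theory Submission
  imports Defs
begin

text \<open>
  Part (1) holds because \<open>R\<^sub>\<sigma>\<close> is self-adjoint for the pairing, hence weakly continuous, and maps
  \<open>D\<^sub>n x\<close> to \<open>D\<^sub>n R\<^sub>\<sigma> x\<close> or to \<open>0\<close>.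

  For the converses let \<open>E\<close> be the weak closure of the span of all \<open>D\<^sub>n x\<close>, a dilation-invariant
  subspace, and let \<open>T\<^sub>N\<close> be the part of \<open>x\<close> on the variables of index at least \<open>N\<close>, so that
  \<open>T\<^sub>N = f\<^sub>N T\<^sub>N\<^sub>+\<^sub>1\<close>. Either hypothesis is needed only to get
  \<open>g T\<^sub>N\<^sub>+\<^sub>1 \<in> X\<close> for \<open>g \<in> X\<^sub>N\<close>. No coefficient of such a product involves a summation, because the
  variables are disjoint; so \<open>g \<mapsto> g T\<^sub>N\<^sub>+\<^sub>1\<close> automatically has an adjoint on \<open>X'\<close> and is weakly
  continuous. It maps \<open>q f\<^sub>N\<close> to \<open>q T\<^sub>N\<close>, so if \<open>T\<^sub>N \<in> E\<close>, then z-cyclicity of \<open>f\<^sub>N\<close> puts the image of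
  \<open>1\<close>, which is \<open>T\<^sub>N\<^sub>+\<^sub>1\<close>, into \<open>E\<close>. As \<open>T\<^sub>0 = x \<in> E\<close>, all \<open>T\<^sub>N\<close> lie in \<open>E\<close>. They converge to
  \<open>\<delta>\<^sub>1\<close>, dominated by \<open>x\<close>, hence weakly; so all \<open>\<delta>\<^sub>k = D\<^sub>k \<delta>\<^sub>1\<close> lie in \<open>E\<close>, and \<open>E = X\<close>.
\<close>

section \<open>Dilations and the arithmetic of multi-indices\<close>

interpretation seqs: vector_space seq_scale
  by (rule vector_space_seq_scale)

lemma dilation_add: "dilation n (x + y) = dilation n x + dilation n y"
  by (auto simp: dilation_def fun_eq_iff)

lemma dilation_scale: "dilation n (seq_scale c x) = seq_scale c (dilation n x)"
  by (auto simp: dilation_def seq_scale_def fun_eq_iff)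

lemma dilation_dilation:
  assumes "n \<ge> 1" "k \<ge> 1"
  shows "dilation n (dilation k x) = dilation (n * k) x"
proof
  fix m
  show "dilation n (dilation k x) m = dilation (n * k) x m"
    using assms by (auto simp: dilation_def div_mult2_eq dvd_div_iff_mult mult.commute
      elim: dvd_mult_left)
qed

lemma dilation_1 [simp]: "dilation (Suc 0) x = x"
  by (simp add: dilation_def)

lemma exponents_0 [simp]: "exponents 0 = 0"
  by (rule poly_mapping_eqI) (simp add: exponents.rep_eq)

lemma exponents_1 [simp]: "exponents (Suc 0) = 0"
  by (rule poly_mapping_eqI) (simp add: exponents.rep_eq)

lemma exponents_mult:
  assumes "n > 0" "k > 0"
  shows "exponents (n * k) = exponents n + exponents k"
  using assms prime_nth_prime
  by (intro poly_mapping_eqI)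
     (simp add: exponents.rep_eq lookup_add prime_elem_multiplicity_mult_distrib)

lemma index_nat_add: "index_nat (\<alpha> + \<beta>) = index_nat \<alpha> * index_nat \<beta>"
proof -
  have "\<alpha> + \<beta> = exponents (index_nat \<alpha> * index_nat \<beta>)"
    by (simp add: exponents_mult index_nat_pos exponents_index_nat)
  then show ?thesis
    using index_nat_exponents[of "index_nat \<alpha> * index_nat \<beta>"] index_nat_pos by (simp add: Suc_leI)
qed

lemma index_nat_single: "index_nat (Poly_Mapping.single j k) = nth_prime j ^ k"
  by (cases "k = 0") (auto simp: index_nat_def)

lemma exponents_prime_power: "exponents (nth_prime j ^ k) = Poly_Mapping.single j k"
  by (metis exponents_index_nat index_nat_single)

lemma keys_exponents_mult:
  assumes "n > 0" "k > 0"
  shows "Poly_Mapping.keys (exponents (n * k)) =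
    Poly_Mapping.keys (exponents n) \<union> Poly_Mapping.keys (exponents k)"
  using assms by (auto simp: exponents_mult in_keys_iff lookup_add)

lemma mem_keys_exponents:
  "n > 0 \<Longrightarrow> j \<in> Poly_Mapping.keys (exponents n) \<longleftrightarrow> nth_prime j dvd n"
  using prime_nth_prime[of j] prime_multiplicity_gt_zero_iff[of "nth_prime j" n]
  by (auto simp: in_keys_iff exponents.rep_eq)

text \<open>\<open>index_nat\<close> turns a decomposition of \<gamma> into a factorization of a
  positive integer, which has finitely many divisors.\<close>

lemma finite_mindex_decompositions: "finite {(\<alpha>, \<beta>). \<alpha> + \<beta> = (\<gamma> :: mindex)}"
proof (rule finite_subset)
  let ?D = "{n. n dvd index_nat \<gamma>}"
  show "{(\<alpha>, \<beta>). \<alpha> + \<beta> = \<gamma>} \<subseteq> map_prod exponents exponents ` (?D \<times> ?D)"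
  proof clarify
    fix \<alpha> \<beta> assume "\<gamma> = \<alpha> + \<beta>"
    show "(\<alpha>, \<beta>) \<in> map_prod exponents exponents ` ({n. n dvd index_nat (\<alpha> + \<beta>)} \<times> {n. n dvd index_nat (\<alpha> + \<beta>)})"
      by (rule image_eqI[of _ _ "(index_nat \<alpha>, index_nat \<beta>)"])
        (auto simp: exponents_index_nat index_nat_add)
  qed
  show "finite (map_prod exponents exponents ` (?D \<times> ?D))"
    using index_nat_pos by simp
qed

lemma mps_mult_commute: "mps_mult F G = mps_mult G F"
proof
  fix \<gamma>
  show "mps_mult F G \<gamma> = mps_mult G F \<gamma>"
    unfolding mps_mult_def
    by (rule sum.reindex_bij_witness[of _ prod.swap prod.swap]) (auto simp: add.commute mult.commute)
qed

section \<open>Univariate factors and products in disjoint variables\<close>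

text \<open>The divisors of a prime power are powers of the same prime, so a dilation either shifts
  the coefficients by an exponent or leaves nothing on these powers.\<close>

lemma prime_factor_dilation:
  assumes "n \<ge> 1"
  shows "prime_factor j (dilation n x) =
    (if Poly_Mapping.keys (exponents n) \<subseteq> {j}
     then fps_X ^ multiplicity (nth_prime j) n * prime_factor j x else 0)"
proof (rule fps_ext)
  fix k
  let ?p = "nth_prime j"
  have p: "prime ?p" by (rule prime_nth_prime)
  have dvd: "n dvd ?p ^ k \<longleftrightarrow> Poly_Mapping.keys (exponents n) \<subseteq> {j} \<and> multiplicity ?p n \<le> k"
  proof
    assume "n dvd ?p ^ k"
    then obtain i where "i \<le> k" "n = ?p ^ i"
      using p divides_primepow_nat by blast
    then show "Poly_Mapping.keys (exponents n) \<subseteq> {j} \<and> multiplicity ?p n \<le> k"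
      using p by (auto simp: exponents_prime_power)
  next
    assume "Poly_Mapping.keys (exponents n) \<subseteq> {j} \<and> multiplicity ?p n \<le> k"
    moreover have "Poly_Mapping.lookup (exponents n) j = multiplicity ?p n"
      by (simp add: exponents.rep_eq)
    ultimately have "exponents n = Poly_Mapping.single j (multiplicity ?p n)" "multiplicity ?p n \<le> k"
      by (auto intro!: poly_mapping_eqI simp: lookup_single when_def in_keys_iff subset_iff)
    then show "n dvd ?p ^ k"
      using index_nat_exponents[OF assms] by (metis index_nat_single le_imp_power_dvd)
  qed
  show "fps_nth (prime_factor j (dilation n x)) k =
     fps_nth (if Poly_Mapping.keys (exponents n) \<subseteq> {j}
     then fps_X ^ multiplicity ?p n * prime_factor j x else 0) k"
  proof (cases "n dvd ?p ^ k")
    case True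
    then obtain i where "i \<le> k" "n = ?p ^ i"
      using p divides_primepow_nat by blast
    moreover have "?p \<noteq> 0" using p by auto
    ultimately show ?thesis
      using p True dvd 
      by (auto simp: prime_factor_def dilation_def fps_X_power_mult_nth power_diff)
  next
    case False
    then show ?thesis
      using dvd by (auto simp: prime_factor_def dilation_def fps_X_power_mult_nth)
  qed
qed

text \<open>Cancels the embedding that defines \<open>var_top\<close>, so that continuity on
  \<open>weak_top X\<close> can be pulled back to univariate series.\<close>

lemma prime_factor_inv_bohr_in_var [simp]: "prime_factor j (inv_bohr (in_var j f)) = f"
proof (rule fps_ext)
  fix k
  have "nth_prime j ^ k \<noteq> 0" using prime_nth_prime[of j] by auto
  then show "fps_nth (prime_factor j (inv_bohr (in_var j f))) k = fps_nth f k"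
    by (auto simp: prime_factor_def inv_bohr_def in_var_def exponents_prime_power in_keys_iff lookup_single)
qed

text \<open>\<open>attach p v f\<close> is \<open>\<Sum>\<^sub>k f\<^sub>k D\<^sub>n v\<close> with \<open>n = p\<^sup>k\<close>, that is, \<open>f(\<zeta>\<^sub>j) Bv\<close> for \<open>p = p\<^sub>j\<close>, as long as
  \<open>v\<close> vanishes on the multiples of \<open>p\<close>.\<close>

definition attach :: "nat \<Rightarrow> seq \<Rightarrow> complex fps \<Rightarrow> seq" where
  "attach p v f = (\<lambda>m. fps_nth f (multiplicity p m) * v (m div p ^ multiplicity p m))"

lemma attach_add: "attach p v (f + g) = attach p v f + attach p v g"
  by (auto simp: attach_def algebra_simps)

lemma attach_const_mult: "attach p v (fps_const c * f) = seq_scale c (attach p v f)"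
  by (auto simp: attach_def seq_scale_def)

text \<open>Multiplication by z raises the exponent of p by one. At 0, where
  \<open>multiplicity\<close> is 0 by convention, both sides vanish because of
  \<open>v 0 = 0\<close>.\<close>

lemma attach_X_mult:
  assumes "prime p" "v 0 = 0"
  shows "attach p v (fps_X * f) = dilation p (attach p v f)"
proof
  fix m
  have "multiplicity p m = Suc (multiplicity p k)" if "m = p * k" "m \<noteq> 0" for k
    using that assms prime_gt_1_nat[of p] by (auto simp: multiplicity_times_same)
  moreover have "multiplicity p m = 0" if "\<not> p dvd m"
    using that by (simp add: not_dvd_imp_multiplicity_0)
  ultimately show "attach p v (fps_X * f) m = dilation p (attach p v f) m"
    using assms by (cases "m = 0") (auto simp: attach_def dilation_def prime_gt_0_nat elim!: dvdE)
qed

lemma attach_1: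
  assumes "\<And>m. p dvd m \<Longrightarrow> v m = 0" "prime p"
  shows "attach p v 1 = v"
proof
  fix m
  show "attach p v 1 m = v m"
    using assms by (cases "p dvd m \<and> m \<noteq> 0")
     (auto simp: attach_def not_dvd_imp_multiplicity_0 prime_multiplicity_gt_zero_iff
       simp flip: neq0_conv)
qed

lemma prime_cofactor:
  fixes p m :: nat
  assumes "prime p" "m > 0"
  obtains b where "m = p ^ multiplicity p m * b" "b > 0" "\<not> p dvd b"
  using assms multiplicity_decompose'[of m p] not_prime_unit
  by (metis bot_nat_0.not_eq_extremum dvd_0_right)

text \<open>The identity \<open>T\<^sub>N = f\<^sub>N T\<^sub>N\<^sub>+\<^sub>1\<close> in
  coordinates: for m = p^k b with b prime to p, multiplicativity splits \<open>x m\<close>, and the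
  support of m lies in \<open>{N..}\<close> iff that of b lies in \<open>{Suc N..}\<close>.\<close>

lemma attach_multiplicative:
  assumes "multiplicative x" "x 0 = 0"
  shows "attach (nth_prime N) (restrict_vars {Suc N..} x) (prime_factor N x) = restrict_vars {N..} x"
proof
  fix m
  let ?p = "nth_prime N"
  have p: "prime ?p" by (rule prime_nth_prime)
  show "attach ?p (restrict_vars {Suc N..} x) (prime_factor N x) m = restrict_vars {N..} x m"
  proof (cases "m = 0")
    case True
    then show ?thesis using assms by (simp add: attach_def restrict_vars_def)
  next
    case False
    obtain b k where b: "m = ?p ^ k * b" "b > 0" "\<not> ?p dvd b" and k: "k = multiplicity ?p m"
      using prime_cofactor[OF p] False by blast
    have pk: "?p ^ k > 0" using p by (simp add: prime_gt_0_nat)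
    have "Poly_Mapping.keys (exponents m) = Poly_Mapping.keys (Poly_Mapping.single N k) \<union> Poly_Mapping.keys (exponents b)"
      using b pk by (simp add: keys_exponents_mult exponents_prime_power)
    moreover have "N \<notin> Poly_Mapping.keys (exponents b)"
      using b mem_keys_exponents by simp
    moreover have "{N..} = insert N {Suc N..}" by auto
    moreover have "Poly_Mapping.keys (Poly_Mapping.single N k) \<subseteq> insert N {Suc N..}" by simp
    ultimately have "Poly_Mapping.keys (exponents m) \<subseteq> {N..} \<longleftrightarrow> Poly_Mapping.keys (exponents b) \<subseteq> {Suc N..}"
      by (simp only: Un_subset_iff subset_insert simp_thms)
    moreover have "x m = x (?p ^ k) * x b"
    proof -
      have "coprime (?p ^ k) b"
        using prime_imp_coprime[OF p b(3)] by simp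
      then show ?thesis
        using assms(1) b pk unfolding multiplicative_def by (auto simp: Suc_le_eq)
    qed
    moreover have "m div ?p ^ k = b"
      using b(1) pk by (metis nonzero_mult_div_cancel_left less_numeral_extra(3))
    ultimately show ?thesis
      by (auto simp: attach_def restrict_vars_def prime_factor_def simp flip: k)
  qed
qed

text \<open>Since j is not among the variables of the second factor, only the splitting of \<gamma>
  into its j-part and the rest contributes, and each coefficient is a single term.\<close>

lemma mps_mult_attach:
  "mps_mult (bohr (restrict_vars {j} g)) (bohr (restrict_vars {Suc j..} x)) =
   bohr (attach (nth_prime j) (restrict_vars {Suc j..} x) (prime_factor j g))"
proof
  fix \<gamma> :: mindex
  let ?p = "nth_prime j"
  let ?v = "restrict_vars {Suc j..} x"
  let ?k = "Poly_Mapping.lookup \<gamma> j"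
  let ?f = "\<lambda>(\<alpha>, \<beta>). bohr (restrict_vars {j} g) \<alpha> * bohr ?v \<beta>"
  have p: "prime ?p" by (rule prime_nth_prime)
  obtain b where b: "index_nat \<gamma> = ?p ^ ?k * b" "b > 0" "\<not> ?p dvd b"
    using prime_cofactor[OF p index_nat_pos] by (metis multiplicity_index_nat)
  define \<alpha> where "\<alpha> = Poly_Mapping.single j ?k"
  define \<beta> where "\<beta> = exponents b"
  have \<beta>: "index_nat \<beta> = b"
    using b by (simp add: \<beta>_def index_nat_exponents Suc_leI)
  have \<gamma>: "\<alpha> + \<beta> = \<gamma>"
    by (metis \<alpha>_def \<beta> b(1) exponents_index_nat index_nat_add index_nat_single)
  have "mps_mult (bohr (restrict_vars {j} g)) (bohr ?v) \<gamma> = sum ?f {(\<alpha>, \<beta>). \<alpha> + \<beta> = \<gamma>}"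
    by (simp add: mps_mult_def)
  also have "\<dots> = sum ?f {(\<alpha>, \<beta>)}"
  proof (rule sum.mono_neutral_right[OF finite_mindex_decompositions])
    have "?f (\<alpha>', \<beta>') = 0" if *: "\<gamma> = \<alpha>' + \<beta>'" "(\<alpha>', \<beta>') \<noteq> (\<alpha>, \<beta>)" for \<alpha>' \<beta>'
    proof -
      have "bohr (restrict_vars {j} g) \<alpha>' * bohr ?v \<beta>' = 0"
      proof (rule ccontr)
        assume "bohr (restrict_vars {j} g) \<alpha>' * bohr ?v \<beta>' \<noteq> 0"
        then have keys: "Poly_Mapping.keys \<alpha>' \<subseteq> {j}" "Poly_Mapping.keys \<beta>' \<subseteq> {Suc j..}"
          by (auto simp: bohr_def restrict_vars_def exponents_index_nat split: if_splits)
        then have "j \<notin> Poly_Mapping.keys \<beta>'"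
          by auto
        then have "Poly_Mapping.lookup \<alpha>' j = ?k"
          using * by (simp add: lookup_add in_keys_iff)
        then have "\<alpha>' = \<alpha>"
          using keys by (intro poly_mapping_eqI)
            (auto simp: \<alpha>_def lookup_single when_def in_keys_iff subset_iff)
        then show False
          using * \<gamma> by auto
      qed
      then show ?thesis by simp
    qed
    then show "\<forall>i\<in>{(\<alpha>, \<beta>). \<alpha> + \<beta> = \<gamma>} - {(\<alpha>, \<beta>)}. ?f i = 0"
      by blast
  qed (use \<gamma> in simp)
  also have "\<dots> = bohr (attach ?p ?v (prime_factor j g)) \<gamma>"
  proof -
    have "index_nat \<gamma> div ?p ^ ?k = b"
      using b p by (metis nonzero_mult_div_cancel_left power_not_zero not_prime_0)
    then show ?thesis
      using \<beta> by (auto simp: bohr_def attach_def prime_factor_def multiplicity_index_nat \<alpha>_def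
         index_nat_single restrict_vars_def exponents_prime_power)
  qed
  finally show "mps_mult (bohr (restrict_vars {j} g)) (bohr ?v) \<gamma> = bohr (attach ?p ?v (prime_factor j g)) \<gamma>" .
qed

section \<open>Coordinatewise convergence of the tails\<close>

lemma nth_prime_ge: "j < nth_prime j"
proof -
  have "strict_mono nth_prime"
    unfolding nth_prime_def strict_mono_def using enumerate_mono[OF _ primes_infinite] by auto
  then have "i < nth_prime i" for i
  proof (induction i)
    case 0
    show ?case using prime_gt_0_nat[OF prime_nth_prime] .
  next
    case (Suc i)
    then have "nth_prime i < nth_prime (Suc i)" by (simp add: strict_mono_def)
    then show ?case using Suc by linarith
  qed
  then show ?thesis .
qed

text \<open>An m > 1 has a prime divisor, whose index is less than that prime and hence less than m.
  So coordinate m has its limit value from N = m on.\<close>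

lemma tail_tendsto_unit_seq:
  assumes "multiplicative x" "x 0 = 0"
  shows "(\<lambda>N. restrict_vars {N..} x m) \<longlonglongrightarrow> unit_seq 1 m"
proof (rule tendsto_eventually, rule eventually_sequentiallyI)
  fix N assume "m \<le> N"
  consider "m = 0" | "m = 1" | "m > 1" by linarith
  then show "restrict_vars {N..} x m = unit_seq 1 m"
  proof cases
    case 3
    then obtain q where "prime q" "q dvd m"
      using prime_factor_nat[of m] by auto
    then obtain j where j: "nth_prime j dvd m"
      using nth_prime_surj by metis
    then have "nth_prime j \<le> m" using 3 by (simp add: dvd_imp_le)
    then have "j < N" using nth_prime_ge[of j] \<open>m \<le> N\<close> by linarith
    moreover have "j \<in> Poly_Mapping.keys (exponents m)"
      using j 3 by (simp add: mem_keys_exponents)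
    ultimately show ?thesis
      using 3 by (auto simp: restrict_vars_def unit_seq_def)
  qed (use assms in \<open>auto simp: restrict_vars_def unit_seq_def multiplicative_def\<close>)
qed

section \<open>The transpose of \<open>attach\<close>\<close>

text \<open>Serves to reindex sums by p-part and cofactor; since p divides 0, the condition on b
  also excludes 0.\<close>

lemma bij_betw_prime_power_times:
  fixes p :: nat
  assumes "prime p"
  shows "bij_betw (\<lambda>(k, b). p ^ k * b) (UNIV \<times> {b. \<not> p dvd b}) (- {0})"
proof (rule bij_betw_byWitness[where f' = "\<lambda>m. (multiplicity p m, m div p ^ multiplicity p m)"])
  have *: "multiplicity p (p ^ k * b) = k" if "\<not> p dvd b" for k b
  proof -
    have "b \<noteq> 0" using that by (metis dvd_0_right)
    then show ?thesis
      using that assms by (simp add: prime_elem_multiplicity_mult_distrib not_dvd_imp_multiplicity_0)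
  qed
  have "p > 0" using assms by (simp add: prime_gt_0_nat)
  then show "\<forall>a\<in>UNIV \<times> {b. \<not> p dvd b}.
      (\<lambda>m. (multiplicity p m, m div p ^ multiplicity p m)) ((\<lambda>(k, b). p ^ k * b) a) = a"
    using * by auto
  show "\<forall>m\<in>- {0}. (\<lambda>(k, b). p ^ k * b) (multiplicity p m, m div p ^ multiplicity p m) = m"
    by (simp add: multiplicity_dvd)
  show "(\<lambda>(k, b). p ^ k * b) ` (UNIV \<times> {b. \<not> p dvd b}) \<subseteq> - {0}"
    using \<open>p > 0\<close> by (auto intro!: Nat.gr0I)
  show "(\<lambda>m. (multiplicity p m, m div p ^ multiplicity p m)) ` (- {0}) \<subseteq> UNIV \<times> {b. \<not> p dvd b}"
    using multiplicity_decompose[of _ p] prime_gt_1_nat[of p] assms by auto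
qed

text \<open>The transpose of \<open>g \<mapsto> attach p v (prime_factor j g)\<close> for
  \<open>p = nth_prime j\<close>. It is supported on the powers of p because only those coordinates
  of g enter the product.\<close>

definition attach_adjoint :: "nat \<Rightarrow> seq \<Rightarrow> seq \<Rightarrow> seq" where
  "attach_adjoint p v y = (\<lambda>a. if a \<in> range ((^) p) then \<Sum>\<^sub>\<infinity>b | \<not> p dvd b. v b * y (a * b) else 0)"

text \<open>The coefficients of the product are single terms \<open>g (p ^ k) * v b\<close>, so its
  pairing with y is an unordered double sum over k and b. Summing over b first gives
  \<open>pairing g w\<close>.\<close>

lemma attach_adjoint_pairing:
  assumes v: "v 0 = 0"
    and sm: "summable (\<lambda>m. cmod (attach (nth_prime j) v (prime_factor j g) m * y m))"
  defines "w \<equiv> attach_adjoint (nth_prime j) v y"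
  shows "summable (\<lambda>m. cmod (g m * w m))"
    and "pairing (attach (nth_prime j) v (prime_factor j g)) y = pairing g w"
proof -
  define p where "p = nth_prime j"
  define h where "h = attach p v (prime_factor j g)"
  define B where "B = {b. \<not> p dvd b}"
  have p: "prime p" unfolding p_def by (rule prime_nth_prime)
  have h0: "h 0 = 0" using v by (simp add: h_def attach_def)
  have bij: "bij_betw (\<lambda>(k, b). p ^ k * b) (UNIV \<times> B) (- {0})"
    using bij_betw_prime_power_times[OF p] by (simp add: B_def)
  \<comment> \<open>Absolute convergence gives unordered summability, which justifies the reindexing
    and the iterated summation below.\<close>
  have s0: "(\<lambda>m. h m * y m) summable_on UNIV"
    using sm norm_summable_imp_summable_on by (simp add: h_def p_def)
  have s1: "(\<lambda>m. h m * y m) summable_on - {0}"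
    using s0 summable_on_subset_banach by blast
  have hval: "h (p ^ k * b) = g (p ^ k) * v b" if "b \<in> B" for k b
  proof -
    have "b \<noteq> 0" using that unfolding B_def by (metis dvd_0_right mem_Collect_eq)
    then have "multiplicity p (p ^ k * b) = k"
      using that p by (simp add: B_def prime_elem_multiplicity_mult_distrib not_dvd_imp_multiplicity_0)
    then show ?thesis
      using p by (simp add: h_def attach_def prime_factor_def prime_gt_0_nat p_def)
  qed
  define F where "F = (\<lambda>(k, b). g (p ^ k) * (v b * y (p ^ k * b)))"
  have F: "F i = (\<lambda>m. h m * y m) ((\<lambda>(k, b). p ^ k * b) i)" if "i \<in> UNIV \<times> B" for i
    using that hval by (auto simp: F_def)
  have s2: "F summable_on (UNIV \<times> B)"
    using s1 unfolding summable_on_reindex_bij_betw[OF bij, of "\<lambda>m. h m * y m", symmetric]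
    by (rule summable_on_cong[THEN iffD1, rotated]) (simp add: F)
  have wval: "w (p ^ k) = (\<Sum>\<^sub>\<infinity>b\<in>B. v b * y (p ^ k * b))" for k
    by (simp add: w_def attach_adjoint_def B_def p_def)
  \<comment> \<open>If the sum defining \<open>w (p ^ k)\<close> diverges, its value is 0; by
    \<open>s2\<close> this can happen only when \<open>g (p ^ k) = 0\<close>, so the identity
    persists.\<close>
  have inner: "(\<Sum>\<^sub>\<infinity>b\<in>B. F (k, b)) = g (p ^ k) * w (p ^ k)" for k
    by (simp add: F_def wval infsum_cmult_right')
  have s3: "(\<lambda>k. g (p ^ k) * w (p ^ k)) summable_on UNIV"
    using summable_on_Sigma_banach[of "\<lambda>k b. F (k, b)" UNIV "\<lambda>_. B"] s2 by (simp add: inner)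
  have inj: "bij_betw ((^) p) UNIV (range ((^) p))"
    using prime_gt_1_nat[OF p] by (auto simp: bij_betw_def inj_on_def)
  have w0: "w m = 0" if "m \<notin> range ((^) p)" for m
    using that by (simp add: w_def attach_adjoint_def p_def)
  have s4: "(\<lambda>m. g m * w m) summable_on range ((^) p)"
    using s3 summable_on_reindex_bij_betw[OF inj, of "\<lambda>m. g m * w m"] by simp
  also have "?this \<longleftrightarrow> (\<lambda>m. g m * w m) summable_on UNIV"
    using w0 by (intro summable_on_cong_neutral) auto
  finally have s5: "(\<lambda>m. g m * w m) summable_on UNIV" .
  \<comment> \<open>The passage between unordered sums and the series in
    \<open>pairing\<close>.\<close>
  have sums: "infsum f UNIV = suminf f" if "f summable_on UNIV" for f :: "nat \<Rightarrow> complex"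
    using that has_sum_imp_sums has_sum_infsum sums_unique by blast
  show "summable (\<lambda>m. cmod (g m * w m))"
    using s5 summable_on_iff_abs_summable_on_complex summable_on_imp_summable by fastforce
  have "pairing h y = infsum (\<lambda>m. h m * y m) UNIV"
    by (simp add: pairing_def sums s0)
  also have "\<dots> = infsum (\<lambda>m. h m * y m) (- {0})"
    using h0 by (intro infsum_cong_neutral) auto
  also have "\<dots> = infsum F (UNIV \<times> B)"
    unfolding infsum_reindex_bij_betw[OF bij, of "\<lambda>m. h m * y m", symmetric]
    by (rule infsum_cong) (simp add: F)
  also have "\<dots> = (\<Sum>\<^sub>\<infinity>k. g (p ^ k) * w (p ^ k))"
    using infsum_Sigma'_banach[of "\<lambda>k b. F (k, b)" UNIV "\<lambda>_. B"] s2 by (simp add: inner)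
  also have "\<dots> = infsum (\<lambda>m. g m * w m) (range ((^) p))"
    using infsum_reindex_bij_betw[OF inj, of "\<lambda>m. g m * w m"] by simp
  also have "\<dots> = infsum (\<lambda>m. g m * w m) UNIV"
    using w0 by (intro infsum_cong_neutral) auto
  also have "\<dots> = pairing g w"
    by (simp add: pairing_def sums s5)
  finally show "pairing (attach (nth_prime j) v (prime_factor j g)) y = pairing g w"
    by (simp add: h_def p_def)
qed

section \<open>Continuity and convergence in the weak topology\<close>

lemma topspace_weak_top [simp]: "topspace (weak_top X) = X"
proof -
  have "0 \<in> kothe_dual X" by (simp add: kothe_dual_def)
  then have "{x \<in> X. pairing x 0 \<in> UNIV} \<in> {{x\<in>X. pairing x y \<in> U} | y U. y \<in> kothe_dual X \<and> open U}"
    by blast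
  then show ?thesis
    unfolding weak_top_def topology_generated_by_topspace by blast
qed

lemma continuous_map_pairing:
  assumes "y \<in> kothe_dual X"
  shows "continuous_map (weak_top X) euclidean (\<lambda>x. pairing x y)"
proof -
  have "openin (weak_top X) {x \<in> X. pairing x y \<in> U}" if "open U" for U
    unfolding weak_top_def using that assms by (intro topology_generated_by_Basis) blast
  then show ?thesis
    by (simp add: continuous_map_def)
qed

lemma continuous_map_into_weak_top:
  assumes "f \<in> topspace T \<rightarrow> X"
    and "\<And>y. y \<in> kothe_dual X \<Longrightarrow> continuous_map T euclidean (\<lambda>t. pairing (f t) y)"
  shows "continuous_map T (weak_top X) f"
  unfolding weak_top_def
proof (rule continuous_on_generated_topo)
  fix U assume "U \<in> {{x\<in>X. pairing x y \<in> U} | y U. y \<in> kothe_dual X \<and> open U}"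
  then obtain y V where y: "y \<in> kothe_dual X" "open V" "U = {x\<in>X. pairing x y \<in> V}"
    by blast
  then have "f -` U \<inter> topspace T = {t \<in> topspace T. pairing (f t) y \<in> V}"
    using assms(1) by auto
  then show "openin T (f -` U \<inter> topspace T)"
    using openin_continuous_map_preimage[OF assms(2)[OF y(1)]] y(2) by auto
next
  show "f ` topspace T \<subseteq> \<Union> {{x\<in>X. pairing x y \<in> U} | y U. y \<in> kothe_dual X \<and> open U}"
    using assms(1) topspace_weak_top[of X] unfolding weak_top_def topology_generated_by_topspace
    by blast
qed

text \<open>Pairing the values with y amounts to pairing the arguments with w. Restrictions,
  dilations and products all obtain weak continuity from such a transpose.\<close>

lemma continuous_map_weak_top_adjoint:
  assumes "f \<in> X \<rightarrow> X"
    and "\<And>y. y \<in> kothe_dual X \<Longrightarrow> \<exists>w\<in>kothe_dual X. \<forall>x\<in>X. pairing (f x) y = pairing x w"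
  shows "continuous_map (weak_top X) (weak_top X) f"
proof (rule continuous_map_into_weak_top)
  fix y assume "y \<in> kothe_dual X"
  then obtain w where "w \<in> kothe_dual X" "\<forall>x\<in>X. pairing (f x) y = pairing x w"
    using assms(2) by blast
  then show "continuous_map (weak_top X) euclidean (\<lambda>x. pairing (f x) y)"
    using continuous_map_eq[OF continuous_map_pairing, of w X] by simp
qed (use assms in simp)

text \<open>Pairings control the subbasic sets; eventual membership then passes to finite
  intersections and unions by induction on the generation of an open set.\<close>

lemma limitin_weak_top:
  assumes "\<And>i. u i \<in> X" "l \<in> X"
    and "\<And>y. y \<in> kothe_dual X \<Longrightarrow> ((\<lambda>i. pairing (u i) y) \<longlongrightarrow> pairing l y) F"
  shows "limitin (weak_top X) u l F"
  unfolding limitin_def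
proof (intro conjI allI impI)
  fix U assume "openin (weak_top X) U \<and> l \<in> U"
  then have "generate_topology_on {{x\<in>X. pairing x y \<in> U} | y U. y \<in> kothe_dual X \<and> open U} U" "l \<in> U"
    by (auto simp: weak_top_def openin_topology_generated_by)
  then show "\<forall>\<^sub>F i in F. u i \<in> U"
  proof induction
    case (UN K)
    then obtain k where "k \<in> K" "l \<in> k" by blast
    then show ?case using UN(2)[of k] by (auto elim!: eventually_mono)
  next
    case (Basis s)
    then obtain y V where y: "y \<in> kothe_dual X" "open V" "s = {x\<in>X. pairing x y \<in> V}"
      by blast
    then show ?case
      using topological_tendstoD[OF assms(3)[OF y(1)] y(2)] Basis assms(1) by simp
  next
    case (Int a b)
    then show ?case by (simp add: eventually_conj)
  qed simp
qed (use assms(2) topspace_weak_top in metis)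

section \<open>Weakly continuous operators on an ISL\<close>

context ISL
begin

lemma add_closed: "x \<in> X \<Longrightarrow> y \<in> X \<Longrightarrow> x + y \<in> X"
  by (rule seqs.subspace_add[OF subspace])

lemma scale_closed: "x \<in> X \<Longrightarrow> seq_scale c x \<in> X"
  by (rule seqs.subspace_scale[OF subspace])

lemma restrict_vars_closed: "x \<in> X \<Longrightarrow> restrict_vars \<sigma> x \<in> X"
  using solid[of x "restrict_vars \<sigma> x"] by (simp add: restrict_vars_def)

lemma summable_pairing: "x \<in> X \<Longrightarrow> y \<in> kothe_dual X \<Longrightarrow> summable (\<lambda>n. x n * y n)"
  unfolding kothe_dual_def by (auto intro: summable_norm_cancel)

lemma pairing_add:
  "x \<in> X \<Longrightarrow> x' \<in> X \<Longrightarrow> y \<in> kothe_dual X \<Longrightarrow> pairing (x + x') y = pairing x y + pairing x' y"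
  by (simp add: pairing_def algebra_simps suminf_add[OF summable_pairing summable_pairing])

lemma pairing_scale:
  "x \<in> X \<Longrightarrow> y \<in> kothe_dual X \<Longrightarrow> pairing (seq_scale c x) y = c * pairing x y"
  by (simp add: pairing_def seq_scale_def mult.assoc suminf_mult summable_pairing)

lemma continuous_map_translate:
  assumes "a \<in> X"
  shows "continuous_map (weak_top X) (weak_top X) (\<lambda>x. x + a)"
proof (rule continuous_map_into_weak_top)
  fix y assume y: "y \<in> kothe_dual X"
  have "continuous_map (weak_top X) euclidean (\<lambda>x. pairing x y + pairing a y)"
    by (intro continuous_map_add continuous_map_pairing[OF y]) simp
  then show "continuous_map (weak_top X) euclidean (\<lambda>x. pairing (x + a) y)"
    by (rule continuous_map_eq) (use assms y in \<open>simp add: pairing_add\<close>)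
qed (use assms add_closed in auto)

lemma continuous_map_scale: "continuous_map (weak_top X) (weak_top X) (seq_scale c)"
proof (rule continuous_map_into_weak_top)
  fix y assume y: "y \<in> kothe_dual X"
  have "continuous_map euclidean euclidean ((*) c)"
    by (simp add: continuous_on_mult_left)
  from continuous_map_compose[OF continuous_map_pairing[OF y] this]
  show "continuous_map (weak_top X) euclidean (\<lambda>x. pairing (seq_scale c x) y)"
    by (rule continuous_map_eq) (use y in \<open>simp add: pairing_scale\<close>)
qed (auto simp: scale_closed)

lemma continuous_map_restrict_vars:
  "continuous_map (weak_top X) (weak_top X) (restrict_vars \<sigma>)"
proof (rule continuous_map_weak_top_adjoint)
  fix y assume y: "y \<in> kothe_dual X"
  have "summable (\<lambda>n. cmod (x n * restrict_vars \<sigma> y n))" if "x \<in> X" for x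
  proof (rule summable_comparison_test')
    show "summable (\<lambda>n. cmod (x n * y n))" using y that by (simp add: kothe_dual_def)
  qed (simp add: restrict_vars_def norm_mult)
  then have "restrict_vars \<sigma> y \<in> kothe_dual X"
    using y by (simp add: kothe_dual_def restrict_vars_def)
  moreover have "pairing (restrict_vars \<sigma> x) y = pairing x (restrict_vars \<sigma> y)" for x
    unfolding pairing_def restrict_vars_def by (rule suminf_cong) simp
  ultimately show "\<exists>w\<in>kothe_dual X. \<forall>x\<in>X. pairing (restrict_vars \<sigma> x) y = pairing x w"
    by blast
qed (simp add: restrict_vars_closed)

text \<open>The transpose is \<open>y \<mapsto> (\<lambda>m. y (n * m))\<close>; pairing y with
  \<open>dilation n x\<close>, which lies in X, shows that it preserves the dual.\<close>

lemma continuous_map_dilation: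
  assumes "n \<ge> 1"
  shows "continuous_map (weak_top X) (weak_top X) (dilation n)"
proof (rule continuous_map_weak_top_adjoint)
  fix y assume y: "y \<in> kothe_dual X"
  have mono: "strict_mono ((*) n)" using assms by (auto simp: strict_mono_def)
  have 0: "dilation n x m * y m = 0" if "m \<notin> range ((*) n)" for m x
    using that by (auto simp: dilation_def dvd_def)
  have val: "dilation n x (n * m) = x m" for x m
    using assms by (simp add: dilation_def)
  have "summable (\<lambda>m. cmod (x m * y (n * m)))" if "x \<in> X" for x
    using summable_mono_reindex[OF mono, of "\<lambda>m. cmod (dilation n x m * y m)"] y 0
      dilation_closed[OF assms that] by (simp add: val kothe_dual_def)
  then have "(\<lambda>m. y (n * m)) \<in> kothe_dual X"
    using y by (simp add: kothe_dual_def)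
  moreover have "pairing (dilation n x) y = pairing x (\<lambda>m. y (n * m))" for x
    using suminf_mono_reindex[OF mono, of "\<lambda>m. dilation n x m * y m"] 0
    by (simp add: val pairing_def)
  ultimately show "\<exists>w\<in>kothe_dual X. \<forall>x\<in>X. pairing (dilation n x) y = pairing x w"
    by blast
qed (use assms dilation_closed in blast)

lemma continuous_map_attach:
  assumes v: "v 0 = 0"
    and closed: "\<And>g. g \<in> X \<Longrightarrow> attach (nth_prime j) v (prime_factor j g) \<in> X"
  shows "continuous_map (var_top X j) (weak_top X) (attach (nth_prime j) v)"
proof -
  \<comment> \<open>The transpose argument runs on sequences g; the pullback then transfers the
    result to univariate series.\<close>
  have "continuous_map (weak_top X) (weak_top X) (\<lambda>g. attach (nth_prime j) v (prime_factor j g))"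
  proof (rule continuous_map_weak_top_adjoint)
    fix y assume y: "y \<in> kothe_dual X"
    define w where "w = attach_adjoint (nth_prime j) v y"
    have s: "summable (\<lambda>m. cmod (attach (nth_prime j) v (prime_factor j g) m * y m))" if "g \<in> X" for g
      using y closed[OF that] by (simp add: kothe_dual_def)
    \<comment> \<open>0 is not a power of a prime, so w vanishes there, as \<open>kothe_dual\<close>
      demands.\<close>
    have "w 0 = 0"
      using prime_nth_prime[of j] by (auto simp: w_def attach_adjoint_def)
    then have "w \<in> kothe_dual X"
      using attach_adjoint_pairing(1)[OF v s] by (simp add: kothe_dual_def w_def)
    then show "\<exists>w\<in>kothe_dual X. \<forall>g\<in>X. pairing (attach (nth_prime j) v (prime_factor j g)) y = pairing g w"
      using attach_adjoint_pairing(2)[OF v s] w_def by blast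
  qed (simp add: closed)
  from continuous_map_pullback[OF this, of "var_space X j" "\<lambda>f. inv_bohr (in_var j f)"]
  show ?thesis
    by (simp add: var_top_def o_def)
qed

lemma inv_bohr_in_var_prime_factor:
  "g \<in> X \<Longrightarrow> inv_bohr (in_var j (prime_factor j g)) = restrict_vars {j} g"
  by (simp add: in_var_prime_factor inv_bohr_bohr restrict_vars_def at_0)

lemma topspace_var_top [simp]: "topspace (var_top X j) = var_space X j"
  by (auto simp: var_top_def topspace_pullback_topology var_space_def
      inv_bohr_in_var_prime_factor restrict_vars_closed)

text \<open>Followed by the embedding that defines \<open>var_top\<close>, the map becomes
  \<open>restrict_vars {j}\<close>, which is weakly continuous.\<close>

lemma continuous_map_prime_factor: "continuous_map (weak_top X) (var_top X j) (prime_factor j)"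
  unfolding var_top_def
proof (rule continuous_map_pullback')
  show "continuous_map (weak_top X) (weak_top X) ((\<lambda>f. inv_bohr (in_var j f)) \<circ> prime_factor j)"
    by (rule continuous_map_eq[OF continuous_map_restrict_vars[of "{j}"]])
      (simp add: inv_bohr_in_var_prime_factor)
qed (auto simp: var_space_def)

section \<open>Weak closures and dominated limits\<close>

text \<open>Continuity in one summand at a time is enough: the closure absorbs first translations by
  elements of S, then by its own elements.\<close>

lemma subspace_closure:
  assumes S: "seqs.subspace S" "S \<subseteq> X"
  shows "seqs.subspace (weak_top X closure_of S)"
proof -
  let ?E = "weak_top X closure_of S"
  have SE: "S \<subseteq> ?E" and EX: "?E \<subseteq> X"
    using S closure_of_subset[of S "weak_top X"] closure_of_subset_topspace[of "weak_top X" S] by auto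
  have invariant: "f z \<in> ?E"
    if "continuous_map (weak_top X) (weak_top X) f" "f ` S \<subseteq> ?E" "z \<in> ?E" for f z
    using continuous_map_image_closure_subset[OF that(1), of S] closure_of_mono[OF that(2)] that(3)
    by fastforce
  have SE_add: "z + a \<in> ?E" if "a \<in> S" "z \<in> ?E" for a z
    using that S SE by (intro invariant[OF continuous_map_translate]) (auto intro: seqs.subspace_add)
  show ?thesis
  proof (rule seqs.subspaceI)
    show "0 \<in> ?E"
      using SE seqs.subspace_0[OF S(1)] by blast
  next
    fix z a assume z: "z \<in> ?E" and a: "a \<in> ?E"
    have "(\<lambda>z. z + a) ` S \<subseteq> ?E"
      using SE_add a by (auto simp: add.commute[of _ a])
    then show "z + a \<in> ?E"
      using invariant[OF continuous_map_translate _ z] a EX by blast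
  next
    fix c z assume "z \<in> ?E"
    moreover have "seq_scale c ` S \<subseteq> ?E"
      using SE seqs.subspace_scale[OF S(1)] by blast
    ultimately show "seq_scale c z \<in> ?E"
      using invariant[OF continuous_map_scale] by blast
  qed
qed

text \<open>Solidity puts l into X. For y in the dual, the terms \<open>cmod (x k * y k)\<close>
  form a summable majorant, so Tannery's theorem gives convergence of the pairings.\<close>

lemma dominated_limit_closed:
  assumes E: "closedin (weak_top X) E" and u: "\<And>i. u i \<in> E"
    and "x \<in> X" and dom: "\<And>i n. cmod (u i n) \<le> cmod (x n)"
    and lim: "\<And>n. (\<lambda>i. u i n) \<longlonglongrightarrow> l n"
  shows "l \<in> E"
proof (rule limitin_closedin[OF _ E])
  have "cmod (l n) \<le> cmod (x n)" for n
    using dom by (intro Lim_norm_ubound[OF _ lim[of n]]) auto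
  then have "l \<in> X" using solid \<open>x \<in> X\<close> by blast
  moreover have "u i \<in> X" for i using u closedin_subset[OF E] by auto
  ultimately show "limitin (weak_top X) u l sequentially"
  proof (intro limitin_weak_top)
    fix y assume y: "y \<in> kothe_dual X"
    have "\<forall>\<^sub>F (k, i) in at_top \<times>\<^sub>F sequentially. cmod (u i k * y k) \<le> cmod (x k * y k)"
      using dom by (intro always_eventually) (auto simp: norm_mult intro: mult_right_mono)
    moreover have "summable (\<lambda>k. cmod (x k * y k))"
      using y \<open>x \<in> X\<close> by (simp add: kothe_dual_def)
    ultimately show "(\<lambda>i. pairing (u i) y) \<longlonglongrightarrow> pairing l y"
      unfolding pairing_def
      using tannerys_theorem[of "\<lambda>k i. u i k * y k" "\<lambda>k. l k * y k" sequentially] lim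
      by (simp add: tendsto_mult)
  qed
qed (use u in auto)

section \<open>Necessity: restrictions and factors of a cyclic element\<close>

lemma cyclic_in_restrict_vars:
  assumes "cyclic X x"
  shows "cyclic_in X \<sigma> (restrict_vars \<sigma> x)"
proof -
  let ?T = "subtopology (weak_top X) (restrict_vars \<sigma> ` X)"
  let ?S = "seqs.span {dilation n x | n. n \<ge> 1}"
  let ?S' = "seqs.span {dilation n (restrict_vars \<sigma> x) | n. n \<ge> 1 \<and> Poly_Mapping.keys (exponents n) \<subseteq> \<sigma>}"
  have x: "x \<in> X" and cl: "weak_top X closure_of ?S = X"
    using assms by (auto simp: cyclic_def)
  have T: "topspace ?T = restrict_vars \<sigma> ` X"
    using restrict_vars_closed by auto
  have "continuous_map (weak_top X) ?T (restrict_vars \<sigma>)"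
    by (simp add: continuous_map_in_subtopology continuous_map_restrict_vars)
  from continuous_map_image_closure_subset[OF this, of ?S]
  have "restrict_vars \<sigma> ` X \<subseteq> ?T closure_of restrict_vars \<sigma> ` ?S"
    by (simp only: cl)
  moreover have "restrict_vars \<sigma> ` ?S \<subseteq> ?S'"
  proof -
    \<comment> \<open>The support of n k is the union of the supports of n and k, so the restriction
      keeps coordinate n k of \<open>dilation n x\<close> iff both supports lie in \<sigma>.\<close>
    have dil: "restrict_vars \<sigma> (dilation n x) =
       (if Poly_Mapping.keys (exponents n) \<subseteq> \<sigma> then dilation n (restrict_vars \<sigma> x) else 0)"
      if "n \<ge> 1" for n
    proof
      fix m
      show "restrict_vars \<sigma> (dilation n x) m =
       (if Poly_Mapping.keys (exponents n) \<subseteq> \<sigma> then dilation n (restrict_vars \<sigma> x) else 0) m"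
      proof (cases "n dvd m \<and> m > 0")
        case True
        then obtain k where "m = n * k" "k > 0" by auto
        then show ?thesis
          using that by (simp add: restrict_vars_def dilation_def keys_exponents_mult)
      next
        case False
        then show ?thesis
          using x at_0 by (auto simp: restrict_vars_def dilation_def)
      qed
    qed
    have "restrict_vars \<sigma> z \<in> ?S'" if "z \<in> ?S" for z
      using that
    proof (induction rule: seqs.span_induct_alt)
      case base
      have "restrict_vars \<sigma> 0 = 0" by (auto simp: restrict_vars_def)
      then show ?case by (simp only: seqs.span_zero)
    next
      case (step c d z)
      have "restrict_vars \<sigma> (seq_scale c d + z) = seq_scale c (restrict_vars \<sigma> d) + restrict_vars \<sigma> z"
        by (auto simp: restrict_vars_def seq_scale_def)
      moreover obtain n where n: "n \<ge> 1" "d = dilation n x"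
        using step(1) by blast
      have "restrict_vars \<sigma> d \<in> ?S'"
      proof (cases "Poly_Mapping.keys (exponents n) \<subseteq> \<sigma>")
        case True
        then have "restrict_vars \<sigma> d = dilation n (restrict_vars \<sigma> x)"
          unfolding n(2) dil[OF n(1)] by (rule if_P)
        then show ?thesis using n(1) True by (intro seqs.span_base) blast
      next
        case False
        then have "restrict_vars \<sigma> d = 0"
          unfolding n(2) dil[OF n(1)] by (rule if_not_P)
        then show ?thesis by (simp only: seqs.span_zero)
      qed
      ultimately show ?case
        using step.IH by (simp only: seqs.span_add seqs.span_scale)
    qed
    then show ?thesis by blast
  qed
  ultimately have "restrict_vars \<sigma> ` X \<subseteq> ?T closure_of ?S'"
    using closure_of_mono by blast
  then show ?thesis
    using x closure_of_subset_topspace[of ?T ?S'] T by (auto simp: cyclic_in_def)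
qed

text \<open>\<open>prime_factor j\<close> sends each dilate of x to a monomial multiple of its j-th
  factor or to 0, hence the span to polynomial multiples; continuity preserves density.\<close>

lemma z_cyclic_prime_factor:
  assumes "cyclic X x"
  shows "z_cyclic X j (prime_factor j x)"
proof -
  let ?S = "seqs.span {dilation n x | n. n \<ge> 1}"
  let ?Q = "{fps_of_poly q * prime_factor j x | q. True}"
  have x: "x \<in> X" and cl: "weak_top X closure_of ?S = X"
    using assms by (auto simp: cyclic_def)
  have "prime_factor j z \<in> ?Q" if "z \<in> ?S" for z
    using that
  proof (induction rule: seqs.span_induct_alt)
    case base
    have "prime_factor j 0 = fps_of_poly 0 * prime_factor j x"
      by (auto simp: prime_factor_def fps_eq_iff)
    then show ?case by blast
  next
    case (step c d z)
    then obtain q n where q: "prime_factor j z = fps_of_poly q * prime_factor j x"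
      and n: "n \<ge> 1" "d = dilation n x"
      by blast
    have "\<exists>r. prime_factor j d = fps_of_poly r * prime_factor j x"
      unfolding n(2) prime_factor_dilation[OF n(1)]
      by (metis fps_of_poly_0 fps_of_poly_monom' mult_zero_left)
    then obtain r where r: "prime_factor j d = fps_of_poly r * prime_factor j x" ..
    have "prime_factor j (seq_scale c d + z) = fps_const c * prime_factor j d + prime_factor j z"
      by (simp add: prime_factor_def seq_scale_def fps_eq_iff)
    also have "\<dots> = fps_of_poly (smult c r + q) * prime_factor j x"
      by (simp add: q r fps_of_poly_add fps_of_poly_smult algebra_simps)
    finally show ?case by blast
  qed
  then have "var_top X j closure_of prime_factor j ` ?S \<subseteq> var_top X j closure_of ?Q"
    by (intro closure_of_mono) blast
  moreover have "var_space X j \<subseteq> var_top X j closure_of prime_factor j ` ?S"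
    using continuous_map_image_closure_subset[OF continuous_map_prime_factor, of j ?S] cl
    by (simp add: var_space_def)
  ultimately show ?thesis
    using x closure_of_subset_topspace[of "var_top X j" ?Q] by (auto simp: z_cyclic_def var_space_def)
qed

section \<open>Sufficiency: splitting off one prime at a time\<close>

text \<open>The common core of both converses; \<open>closed\<close> says that multiplication by a
  tail maps each \<open>X\<^sub>j\<close> into X.\<close>

lemma cyclic_if_z_cyclic:
  assumes x: "x \<in> X" "multiplicative x"
    and cyc: "\<And>j. z_cyclic X j (prime_factor j x)"
    and closed: "\<And>j g. g \<in> X \<Longrightarrow>
      attach (nth_prime j) (restrict_vars {Suc j..} x) (prime_factor j g) \<in> X"
  shows "cyclic X x"
proof -
  define S where "S = seqs.span {dilation n x | n. n \<ge> 1}"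
  define E where "E = weak_top X closure_of S"
  have SX: "S \<subseteq> X"
    unfolding S_def using subspace x dilation_closed by (intro seqs.span_minimal) auto
  have SE: "S \<subseteq> E"
    using closure_of_subset[of S "weak_top X"] SX by (simp add: E_def)
  have E_closed: "closedin (weak_top X) E"
    by (simp add: E_def)
  then have EX: "E \<subseteq> X"
    using closedin_subset by fastforce
  have sub: "seqs.subspace E"
    unfolding E_def using SX by (intro subspace_closure) (auto simp: S_def)
  \<comment> \<open>The span is invariant since dilations compose by multiplying their indices; weak
    continuity carries this over to the closure.\<close>
  have dilE: "dilation n z \<in> E" if n: "n \<ge> 1" and "z \<in> E" for n z
  proof -
    have "dilation n z \<in> S" if "z \<in> S" for z
      using that unfolding S_def
    proof (induction rule: seqs.span_induct_alt)
      case base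
      have "dilation n 0 = 0" by (auto simp: dilation_def)
      then show ?case by (simp only: seqs.span_zero)
    next
      case (step c d z)
      then obtain k where "k \<ge> 1" "d = dilation k x" by blast
      then have "dilation n d = dilation (n * k) x" "n * k \<ge> 1"
        using n by (auto simp: dilation_dilation)
      then have "dilation n d \<in> seqs.span {dilation n x | n. n \<ge> 1}"
        by (intro seqs.span_base) blast
      then show ?case
        unfolding dilation_add dilation_scale
        using step.IH by (intro seqs.span_add seqs.span_scale)
    qed
    then have "dilation n ` S \<subseteq> S" by blast
    then show ?thesis
      using continuous_map_image_closure_subset[OF continuous_map_dilation[OF n], of S]
        closure_of_mono \<open>z \<in> E\<close> unfolding E_def by blast
  qed
  have tail: "restrict_vars {N..} x \<in> E" for N
  proof (induction N)
    case 0
    have "restrict_vars {0..} x = x" by (simp add: restrict_vars_def)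
    moreover have "x \<in> S" unfolding S_def by (rule seqs.span_base) (auto intro: exI[of _ 1])
    ultimately show ?case using SE by auto
  next
    case (Suc N)
    define p where "p = nth_prime N"
    define v where "v = restrict_vars {Suc N..} x"
    define f where "f = prime_factor N x"
    have p: "prime p" unfolding p_def by (rule prime_nth_prime)
    have v0: "v 0 = 0" using at_0 x by (simp add: v_def restrict_vars_def)
    \<comment> \<open>Horner's scheme: the induction on q rests on \<open>attach p v f\<close>,
      which is the previous tail, lying in E and on the invariance of E under
      \<open>dilation p\<close>.\<close>
    have "attach p v (fps_of_poly q * f) \<in> E" for q
    proof (induction q)
      case 0
      have "attach p v 0 = 0" by (auto simp: attach_def)
      then show ?case using seqs.subspace_0[OF sub] by (simp only: fps_of_poly_0 mult_zero_left)
    next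
      case (pCons a q)
      have "fps_of_poly (pCons a q) * f = fps_const a * f + fps_X * (fps_of_poly q * f)"
        by (simp add: fps_of_poly_pCons algebra_simps)
      then have "attach p v (fps_of_poly (pCons a q) * f) =
          seq_scale a (attach p v f) + dilation p (attach p v (fps_of_poly q * f))"
        by (simp add: attach_add attach_const_mult attach_X_mult p v0)
      moreover have "attach p v f \<in> E"
        using Suc attach_multiplicative[OF x(2) at_0[OF x(1)]] by (simp add: p_def v_def f_def)
      moreover have "p \<ge> 1" using prime_gt_0_nat[OF p] by linarith
      ultimately show ?case
        using pCons.IH dilE by (simp only: seqs.subspace_add[OF sub] seqs.subspace_scale[OF sub])
    qed
    then have "attach p v ` {fps_of_poly q * f | q. True} \<subseteq> E" by blast
    then have "weak_top X closure_of (attach p v ` {fps_of_poly q * f | q. True}) \<subseteq> E"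
      by (rule closure_of_minimal) (rule E_closed)
    \<comment> \<open>By weak continuity and z-cyclicity, \<open>attach p v\<close> maps all of
      \<open>var_space X N\<close> into E.\<close>
    moreover have "attach p v ` (var_top X N closure_of {fps_of_poly q * f | q. True})
        \<subseteq> weak_top X closure_of (attach p v ` {fps_of_poly q * f | q. True})"
      unfolding p_def using closed v0
      by (intro continuous_map_image_closure_subset continuous_map_attach) (auto simp: v_def)
    moreover have "var_top X N closure_of {fps_of_poly q * f | q. True} = var_space X N"
      using cyc[of N] by (simp add: z_cyclic_def f_def)
    \<comment> \<open>The constant 1 is the factor of \<open>unit_seq 1\<close>; its image under
      \<open>attach p v\<close> is the next tail.\<close>
    moreover have "1 \<in> var_space X N"
    proof -
      have "nth_prime N ^ k = 1 \<longleftrightarrow> k = 0" for k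
        using prime_gt_1_nat[OF prime_nth_prime[of N]] by simp
      then have "prime_factor N (unit_seq 1) = 1"
        by (auto simp: prime_factor_def unit_seq_def fps_eq_iff)
      then show ?thesis using unit_mem unfolding var_space_def by (metis imageI)
    qed
    ultimately have "attach p v 1 \<in> E" by blast
    moreover have "attach p v 1 = v"
    proof (rule attach_1[OF _ p])
      fix m assume "p dvd m"
      show "v m = 0"
      proof (cases "m = 0")
        case False
        then have "N \<in> Poly_Mapping.keys (exponents m)"
          using \<open>p dvd m\<close> by (simp add: mem_keys_exponents p_def)
        then show ?thesis by (auto simp: v_def restrict_vars_def)
      qed (simp add: v0)
    qed
    ultimately show ?case by (simp add: v_def)
  qed
  have "unit_seq 1 \<in> E"
    by (rule dominated_limit_closed[OF E_closed tail x(1) _ tail_tendsto_unit_seq[OF x(2) at_0[OF x(1)]]])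
      (simp add: restrict_vars_def)
  then have unit: "unit_seq n \<in> E" if "n \<ge> 1" for n
    using dilE[OF that, of "unit_seq 1"] that by (simp add: dilation_unit_seq)
  have "z \<in> E" if z: "z \<in> X" for z
  proof -
    \<comment> \<open>The truncations are finite combinations of unit vectors, dominated by z.
      Coordinate 0, whose unit vector is not in X, adds nothing as \<open>z 0 = 0\<close>.\<close>
    define u where "u = (\<lambda>i n. if n < i then z n else 0)"
    have "u i \<in> E" for i
    proof (induction i)
      case 0
      have "u 0 = 0" by (auto simp: u_def)
      then show ?case using seqs.subspace_0[OF sub] by (simp only:)
    next
      case (Suc i)
      have "u (Suc i) = u i + seq_scale (z i) (unit_seq i)"
        by (auto simp: u_def seq_scale_def unit_seq_def fun_eq_iff less_Suc_eq)
      moreover have "seq_scale (z i) (unit_seq i) \<in> E"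
      proof (cases "i = 0")
        case True
        then have "seq_scale (z i) (unit_seq i) = 0"
          using at_0[OF z] by (auto simp: seq_scale_def)
        then show ?thesis using seqs.subspace_0[OF sub] by (simp only:)
      qed (use unit sub in \<open>auto intro: seqs.subspace_scale\<close>)
      ultimately show ?case using Suc by (simp only: seqs.subspace_add[OF sub])
    qed
    moreover have "cmod (u i n) \<le> cmod (z n)" for i n
      by (simp add: u_def)
    moreover have "(\<lambda>i. u i n) \<longlonglongrightarrow> z n" for n
      by (rule tendsto_eventually, rule eventually_sequentiallyI[of "Suc n"]) (simp add: u_def)
    ultimately show ?thesis
      by (rule dominated_limit_closed[OF E_closed _ z])
  qed
  then have "E = X"
    using EX by blast
  then show ?thesis
    using x(1) unfolding cyclic_def E_def S_def by blast
qed

end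

theorem proposition5p3:
  fixes X :: "seq set" and nrm :: "seq \<Rightarrow> real"
  assumes "ISL X nrm"
  shows
    "((\<forall>x. cyclic X x \<longrightarrow> (\<forall>\<sigma>. \<sigma> \<noteq> {} \<longrightarrow> cyclic_in X \<sigma> (restrict_vars \<sigma> x))) \<and>
      (\<forall>x. cyclic X x \<and> multiplicative x \<longrightarrow> (\<forall>j. z_cyclic X j (prime_factor j x)))) \<and>
     (multiplicative_norm X nrm \<longrightarrow>
        (\<forall>x\<in>X. multiplicative x \<and> (\<forall>j. z_cyclic X j (prime_factor j x)) \<longrightarrow> cyclic X x)) \<and>
     (\<forall>x\<in>X. multiplicative x \<and>
          (\<forall>j. in_var j (prime_factor j x) \<in> Mult X) \<and>
          (\<forall>N\<ge>1. tail_factor N x \<in> Mult X) \<longrightarrow>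
        (\<forall>j. z_cyclic X j (prime_factor j x)) \<longrightarrow> cyclic X x)"
proof -
  interpret ISL X nrm by fact
  let ?prod = "\<lambda>x j g. mps_mult (bohr (restrict_vars {j} g)) (bohr (restrict_vars {Suc j..} x))"
  \<comment> \<open>Each converse is reduced to placing the product of a series in the variable j
    with the following tail in the Bohr image of X.\<close>
  have cyclicI: "cyclic X x"
    if x: "x \<in> X" "multiplicative x" "\<And>j. z_cyclic X j (prime_factor j x)"
      and prod: "\<And>j g. g \<in> X \<Longrightarrow> ?prod x j g \<in> bohr ` X" for x
  proof (rule cyclic_if_z_cyclic[OF x])
    fix j g assume "g \<in> X"
    let ?a = "attach (nth_prime j) (restrict_vars {Suc j..} x) (prime_factor j g)"
    obtain z where "z \<in> X" "bohr ?a = bohr z"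
      using prod[OF \<open>g \<in> X\<close>] unfolding mps_mult_attach by blast
    \<comment> \<open>\<open>bohr\<close> sees only positive indices, so the value at 0 is settled
      before inverting it.\<close>
    moreover have "?a 0 = 0"
      using at_0[OF x(1)] by (simp add: attach_def restrict_vars_def)
    ultimately have "?a = z"
      using at_0 inv_bohr_bohr by metis
    then show "?a \<in> X" using \<open>z \<in> X\<close> by simp
  qed
  have "cyclic X x"
    if "multiplicative_norm X nrm" "x \<in> X" "multiplicative x"
      "\<forall>j. z_cyclic X j (prime_factor j x)" for x
  proof (rule cyclicI)
    fix j g assume "g \<in> X"
    moreover have "{j} \<inter> {Suc j..} = {}" by simp
    ultimately show "?prod x j g \<in> bohr ` X"
      using that unfolding multiplicative_norm_def by blast
  qed (use that in auto)
  moreover have "cyclic X x"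
    if "x \<in> X" "multiplicative x" "\<forall>N\<ge>1. tail_factor N x \<in> Mult X"
      "\<forall>j. z_cyclic X j (prime_factor j x)" for x
  proof (rule cyclicI)
    fix j g assume "g \<in> X"
    then have "bohr (restrict_vars {j} g) \<in> bohr ` X"
      using restrict_vars_closed by blast
    \<comment> \<open>The tails that occur start at \<open>Suc j\<close>, so the hypothesis for N
      \<ge> 1 covers even j = 0.\<close>
    moreover have "bohr (restrict_vars {Suc j..} x) \<in> Mult X"
      using that(3) by (simp add: tail_factor_def)
    ultimately show "?prod x j g \<in> bohr ` X"
      unfolding Mult_def mps_mult_commute[of "bohr (restrict_vars {j} g)"] by blast
  qed (use that in auto)
  ultimately show ?thesis
    using cyclic_in_restrict_vars z_cyclic_prime_factor by blast
qed

end
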